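(* Let $G$ be a simple connected triangle-free graph of order $n$ and minimum degree $\delta\geq 2$, such that $\overline{G}$ is connected. If \[ q(\overline{G})\leq 2(n-1)-\frac{4\delta^2}{n}-\left\lfloor\frac{(n-\delta)^2}{n}\right\rfloor, \] then $G$ is super-$\kappa$.
   Context: $\overline{G}$ is the complement of $G$. $q(H)$ denotes the $Q$-index of a graph $H$, the largest eigenvalue of $D(H)+A(H)$ ($D$ = diagonal degree matrix, $A$ = adjacency matrix). Triangle-free means containing no 3-cycle. A vertex subset $C$ of a connected graph $G$ is a vertex-cut if $G-C$ is disconnected or $G-C=K_1$; $\kappa(G)$ is the minimum size of a vertex-cut, and a vertex-cut is minimum if it has size $\kappa(G)$. $G$ is super-$\kappa$ if every minimum vertex-cut isolates a vertex of minimum degree. *)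

theory Defs
  imports "Graph_Theory.Digraph_Component" "Jordan_Normal_Form.Char_Poly"
begin

text \<open>
  A finite simple graph is a \<^locale>\<open>pair_graph\<close>: a finite, loop-free, symmetric relation
  \<^const>\<open>parcs\<close> on \<^const>\<open>pverts\<close>. Each edge \<open>uv\<close> is stored as the two arcs
  \<open>(u, v)\<close> and \<open>(v, u)\<close>, so the degree of a vertex is its \<^const>\<open>out_degree\<close>.
  The name \<open>connected\<close> also denotes topological connectedness, hence
  the qualified \<^const>\<open>Digraph_Component.connected\<close>.
\<close>

definition complement_graph :: "'a pair_pre_digraph \<Rightarrow> 'a pair_pre_digraph" where
  "complement_graph G = \<lparr> pverts = pverts G,
     parcs = {(u, v). u \<in> pverts G \<and> v \<in> pverts G \<and> u \<noteq> v \<and> (u, v) \<notin> parcs G} \<rparr>"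

definition triangle_free :: "'a pair_pre_digraph \<Rightarrow> bool" where
  "triangle_free G \<longleftrightarrow>
     \<not> (\<exists>u v w. (u, v) \<in> parcs G \<and> (v, w) \<in> parcs G \<and> (w, u) \<in> parcs G)"

definition min_degree :: "'a pair_pre_digraph \<Rightarrow> nat" where
  "min_degree G = Min (out_degree (with_proj G) ` pverts G)"


section \<open>The Q-index\<close>

text \<open>
  Matrices are indexed by natural numbers, so they depend on an enumeration \<open>vs\<close> of the vertices;
  by \<open>eigenvalue_signless_laplacian_iff\<close> below the spectrum does not.
\<close>

definition adjacency_matrix :: "'a pair_pre_digraph \<Rightarrow> 'a list \<Rightarrow> real mat" where
  "adjacency_matrix G vs = mat (length vs) (length vs)
     (\<lambda>(i, j). if (vs ! i, vs ! j) \<in> parcs G then 1 else 0)"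

definition degree_matrix :: "'a pair_pre_digraph \<Rightarrow> 'a list \<Rightarrow> real mat" where
  "degree_matrix G vs = mat (length vs) (length vs)
     (\<lambda>(i, j). if i = j then real (out_degree (with_proj G) (vs ! i)) else 0)"

definition signless_laplacian :: "'a pair_pre_digraph \<Rightarrow> 'a list \<Rightarrow> real mat" where
  "signless_laplacian G vs = degree_matrix G vs + adjacency_matrix G vs"

definition vertex_enum :: "'a pair_pre_digraph \<Rightarrow> 'a list" where
  "vertex_enum G = (SOME vs. distinct vs \<and> set vs = pverts G)"

definition Q_index :: "'a pair_pre_digraph \<Rightarrow> real" where
  "Q_index G = Max {k. eigenvalue (signless_laplacian G (vertex_enum G)) k}"

lemma vertex_enum:
  assumes "finite (pverts G)"
  shows "distinct (vertex_enum G)" "set (vertex_enum G) = pverts G"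
proof -
  have "\<exists>vs. distinct vs \<and> set vs = pverts G"
    using finite_distinct_list[OF assms] by blast
  from someI_ex[OF this]
  show "distinct (vertex_enum G)" "set (vertex_enum G) = pverts G"
    by (simp_all add: vertex_enum_def)
qed

lemma eigenvalue_signless_laplacian_iff:
  assumes vs: "distinct vs" "set vs = pverts G"
  shows "eigenvalue (signless_laplacian G vs) k \<longleftrightarrow>
    (\<exists>x :: 'a \<Rightarrow> real. (\<exists>v\<in>pverts G. x v \<noteq> 0) \<and>
       (\<forall>v\<in>pverts G. real (out_degree (with_proj G) v) * x v
          + (\<Sum>u\<in>pverts G. if (v, u) \<in> parcs G then x u else 0) = k * x v))"
    (is "_ \<longleftrightarrow> (\<exists>x. ?nz x \<and> (\<forall>v\<in>_. ?L x v = k * x v))")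
proof -
  let ?n = "length vs" and ?M = "signless_laplacian G vs"
  have dim [simp]: "dim_row ?M = ?n" "dim_col ?M = ?n"
    by (simp_all add: signless_laplacian_def degree_matrix_def adjacency_matrix_def)
  have bij: "bij_betw (\<lambda>i. vs ! i) {0..<?n} (pverts G)"
    using bij_betw_nth[OF vs(1) refl] vs(2) by (simp add: lessThan_atLeast0)
  have mult: "(?M *\<^sub>v y) $ i = ?L x (vs ! i)"
    if y: "y \<in> carrier_vec ?n" "\<And>j. j < ?n \<Longrightarrow> y $ j = x (vs ! j)" and i: "i < ?n" for x y i
  proof -
    have "(?M *\<^sub>v y) $ i = (\<Sum>j\<in>{0..<?n}. ?M $$ (i, j) * y $ j)"
      using y i by (simp add: scalar_prod_def)
    also have "\<dots> = (\<Sum>j\<in>{0..<?n}.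
        (if i = j then real (out_degree (with_proj G) (vs ! i)) * x (vs ! i) else 0)
        + (if (vs ! i, vs ! j) \<in> parcs G then x (vs ! j) else 0))"
      using y i by (intro sum.cong refl)
        (auto simp: signless_laplacian_def degree_matrix_def adjacency_matrix_def algebra_simps)
    also have "\<dots> = real (out_degree (with_proj G) (vs ! i)) * x (vs ! i)
        + (\<Sum>j\<in>{0..<?n}. if (vs ! i, vs ! j) \<in> parcs G then x (vs ! j) else 0)"
      using i by (simp add: sum.distrib)
    also have "(\<Sum>j\<in>{0..<?n}. if (vs ! i, vs ! j) \<in> parcs G then x (vs ! j) else 0)
        = (\<Sum>u\<in>pverts G. if (vs ! i, u) \<in> parcs G then x u else 0)"
      by (rule sum.reindex_bij_betw[OF bij, where g = "\<lambda>u. if (vs ! i, u) \<in> parcs G then x u else 0"])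
    finally show ?thesis .
  qed
  have all: "(\<forall>v\<in>pverts G. P v) \<longleftrightarrow> (\<forall>i<?n. P (vs ! i))" for P
    using vs(2) by (metis in_set_conv_nth)
  have evec: "eigenvector ?M y k \<longleftrightarrow> ?nz x \<and> (\<forall>v\<in>pverts G. ?L x v = k * x v)"
    if y: "y \<in> carrier_vec ?n" "\<And>j. j < ?n \<Longrightarrow> y $ j = x (vs ! j)" for x y
  proof -
    have "y \<noteq> 0\<^sub>v ?n \<longleftrightarrow> ?nz x"
      using all[of "\<lambda>v. x v = 0"] y by (auto simp: vec_eq_iff)
    moreover have "?M *\<^sub>v y = k \<cdot>\<^sub>v y \<longleftrightarrow> (\<forall>i<?n. (?M *\<^sub>v y) $ i = k * y $ i)"
      using y(1) by (auto simp: vec_eq_iff)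
    ultimately show ?thesis
      using y mult[OF y] by (simp add: eigenvector_def all)
  qed
  show ?thesis
  proof
    assume "eigenvalue ?M k"
    then obtain y where y: "eigenvector ?M y k" by (auto simp: eigenvalue_def)
    define x where "x v = y $ (THE j. j < ?n \<and> vs ! j = v)" for v
    have "y $ j = x (vs ! j)" if "j < ?n" for j
    proof -
      have "(THE i. i < ?n \<and> vs ! i = vs ! j) = j"
        using that vs(1) by (intro the_equality) (auto simp: nth_eq_iff_index_eq)
      then show ?thesis by (simp add: x_def)
    qed
    with y evec[of y x] show "\<exists>x. ?nz x \<and> (\<forall>v\<in>pverts G. ?L x v = k * x v)"
      by (auto simp: eigenvector_def)
  next
    assume "\<exists>x. ?nz x \<and> (\<forall>v\<in>pverts G. ?L x v = k * x v)"
    then obtain x where x: "?nz x \<and> (\<forall>v\<in>pverts G. ?L x v = k * x v)" by blast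
    have "eigenvector ?M (vec ?n (\<lambda>j. x (vs ! j))) k"
      using x by (subst evec[where x = x]) auto
    then show "eigenvalue ?M k" by (auto simp: eigenvalue_def)
  qed
qed


section \<open>Vertex-cuts\<close>

abbreviation del_verts :: "'a pair_pre_digraph \<Rightarrow> 'a set \<Rightarrow> ('a, 'a \<times> 'a) pre_digraph" where
  "del_verts G C \<equiv> induce_subgraph (with_proj G) (pverts G - C)"

text \<open>
  The library's \<^const>\<open>Digraph_Component.connected\<close> is false for the null graph, so
  \<open>C \<noteq> pverts G\<close> is needed to keep the null graph from counting as disconnected.
\<close>

definition vertex_cut :: "'a pair_pre_digraph \<Rightarrow> 'a set \<Rightarrow> bool" where
  "vertex_cut G C \<longleftrightarrow> C \<subseteq> pverts G \<and> C \<noteq> pverts G \<and>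
     (\<not> Digraph_Component.connected (del_verts G C) \<or> card (verts (del_verts G C)) = 1)"

definition vertex_connectivity :: "'a pair_pre_digraph \<Rightarrow> nat" where
  "vertex_connectivity G = Min (card ` {C. vertex_cut G C})"

definition minimum_vertex_cut :: "'a pair_pre_digraph \<Rightarrow> 'a set \<Rightarrow> bool" where
  "minimum_vertex_cut G C \<longleftrightarrow> vertex_cut G C \<and> card C = vertex_connectivity G"

definition isolates :: "'a pair_pre_digraph \<Rightarrow> 'a set \<Rightarrow> 'a \<Rightarrow> bool" where
  "isolates G C v \<longleftrightarrow> v \<in> verts (del_verts G C) \<and> out_degree (del_verts G C) v = 0"

definition super_kappa :: "'a pair_pre_digraph \<Rightarrow> bool" where
  "super_kappa G \<longleftrightarrow> (\<forall>C. minimum_vertex_cut G C \<longrightarrow>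
     (\<exists>v. isolates G C v \<and> out_degree (with_proj G) v = min_degree G))"

end

theory Submission
  imports Defs "HOL-Analysis.Function_Topology"
begin

text \<open>
  For every vector \<open>x\<close> the Rayleigh quotient bounds the \<open>Q\<close>-index of the complement from below:
  \<open>(n - 2) \<Sum> x\<^sub>v\<^sup>2 + (\<Sum> x\<^sub>v)\<^sup>2 - \<Sum> (x\<^sub>u + x\<^sub>v)\<^sup>2 \<le> q \<Sum> x\<^sub>v\<^sup>2\<close>, the last sum on the left running over the
  edges of \<open>G\<close>. If \<open>G\<close> is not super-\<open>\<kappa>\<close>, some cut \<open>C\<close> with \<open>|C| \<le> \<delta>\<close> splits the other vertices into
  \<open>X\<close> and \<open>Y\<close> such that every vertex has a neighbour in its own part. The ends of an edge inside \<open>X\<close>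
  have disjoint neighbourhoods in \<open>X \<union> C\<close>, so \<open>|X| + |C| \<ge> 2\<delta>\<close>, and likewise for \<open>Y\<close>. Mantel's theorem
  with vertex weights, applied to \<open>X \<union> C\<close> and to \<open>Y \<union> C\<close>, then bounds the sum over edges.

  With \<open>|X| \<le> |Y|\<close>, the vector \<open>x = 1\<close> contradicts the hypothesis on \<open>q\<close> if \<open>|C| < \<delta>\<close>, and also if
  \<open>|C| = \<delta> < |X|\<close> and \<open>n \<ge> 6\<delta> + 2\<close>. If \<open>|C| = \<delta> < |X|\<close> and \<open>n \<le> 6\<delta> + 1\<close>, the floor loses too much for a
  count of edges, but the vertices of \<open>C\<close> have large degree and lowering \<open>x\<close> to \<open>1/2\<close> on \<open>C\<close> gains enough.
  If \<open>|X| = |C| = \<delta>\<close>, the vertices of \<open>X\<close> have the least degree \<open>\<delta>\<close>, and one raises \<open>x\<close> to \<open>3/2\<close> on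
  \<open>X\<close> instead.
\<close>

section \<open>Rayleigh quotients and the Q-index\<close>

text \<open>Tychonoff's theorem, transported to the function type with its product topology, so that
  vectors can stay functions on vertices.\<close>

lemma compact_box_functions:
  fixes S :: "'a \<Rightarrow> 'b::topological_space set"
  assumes "\<And>i. compact (S i)"
  shows "compact {x. \<forall>i. x i \<in> S i}"
proof -
  have "compactin (product_topology (\<lambda>_. euclidean) UNIV) (PiE UNIV S)"
    using assms by (subst compactin_PiE) auto
  then show ?thesis
    by (simp add: euclidean_product_topology PiE_UNIV_domain Pi_def)
qed

lemma continuous_quadratic_form:
  fixes M :: "'a \<Rightarrow> 'a \<Rightarrow> real"
  shows "continuous_on A (\<lambda>x. \<Sum>u\<in>V. \<Sum>v\<in>V. M u v * x u * x v)"
proof -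
  have "continuous_on A (\<lambda>x::'a \<Rightarrow> real. x i)" for i
    by (rule continuous_on_subset[OF continuous_on_product_coordinates]) simp
  then show ?thesis
    by (intro continuous_intros)
qed

text \<open>Pinning the coordinates outside \<open>V\<close> to 0 makes the sphere a closed subset
  of a compact box. Truncating any \<open>x\<close> to \<open>V\<close> changes neither the form nor
  the norm, so the maximum over the box is global.\<close>

lemma quadratic_form_max_on_sphere:
  fixes M :: "'a \<Rightarrow> 'a \<Rightarrow> real"
  assumes "finite V" "V \<noteq> {}"
  shows "\<exists>z. (\<Sum>v\<in>V. (z v)\<^sup>2) = 1 \<and>
    (\<forall>x. (\<Sum>v\<in>V. (x v)\<^sup>2) = 1 \<longrightarrow> (\<Sum>u\<in>V. \<Sum>v\<in>V. M u v * x u * x v)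
      \<le> (\<Sum>u\<in>V. \<Sum>v\<in>V. M u v * z u * z v))"
proof -
  define Q where "Q x = (\<Sum>u\<in>V. \<Sum>v\<in>V. M u v * x u * x v)" for x
  define N :: "('a \<Rightarrow> real) \<Rightarrow> real" where "N x = (\<Sum>v\<in>V. (x v)\<^sup>2)" for x
  let ?I = "\<lambda>i. if i \<in> V then {-1..1::real} else {0}"
  let ?K = "{x. \<forall>i. x i \<in> ?I i} \<inter> {x. N x = 1}"
  have "continuous_on UNIV N"
  proof -
    have "continuous_on UNIV (\<lambda>x::'a \<Rightarrow> real. x i)" for i
      by simp
    then show ?thesis unfolding N_def by (intro continuous_intros)
  qed
  then have "closed {x. N x = 1}"
    by (intro closed_Collect_eq continuous_on_const)
  then have "compact ?K"
    by (intro compact_Int_closed compact_box_functions) auto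
  moreover have "?K \<noteq> {}"
  proof -
    obtain w where "w \<in> V" using assms(2) by auto
    have "(\<lambda>i. if i = w then 1 else 0) \<in> ?K"
      using \<open>w \<in> V\<close> assms(1) by (auto simp: N_def if_distrib[of "\<lambda>t. t\<^sup>2"] cong: if_cong)
    then show ?thesis by (metis (no_types, lifting) empty_iff)
  qed
  moreover have "continuous_on ?K Q"
    unfolding Q_def by (rule continuous_quadratic_form)
  ultimately obtain z where z: "z \<in> ?K" "\<And>x. x \<in> ?K \<Longrightarrow> Q x \<le> Q z"
    using continuous_attains_sup[of ?K Q] by blast
  have "Q x \<le> Q z" if x: "N x = 1" for x
  proof -
    define y where "y i = (if i \<in> V then x i else 0)" for i
    have N: "N y = N x" and Q: "Q y = Q x"
      unfolding N_def Q_def by (auto simp: y_def intro!: sum.cong)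
    have "\<bar>x i\<bar> \<le> 1" if "i \<in> V" for i
    proof -
      have "(x i)\<^sup>2 \<le> N x"
        unfolding N_def using that assms(1) by (intro member_le_sum) auto
      then show ?thesis using x by (simp add: abs_square_le_1)
    qed
    then have "y \<in> ?K"
      using N x by (auto simp: y_def abs_le_iff minus_le_iff)
    then have "Q y \<le> Q z" by (rule z(2))
    then show ?thesis unfolding Q .
  qed
  moreover have "N z = 1" using IntD2[OF z(1)] by (rule CollectD)
  ultimately have "N z = 1 \<and> (\<forall>x. N x = 1 \<longrightarrow> Q x \<le> Q z)" by blast
  then show ?thesis
    unfolding Q_def N_def by (rule exI[of _ z])
qed

text \<open>The variational principle: perturbing a maximiser \<open>z\<close> of the Rayleigh quotient to
  \<open>z + t e\<^sub>w\<close> shows that the residual \<open>M z - k z\<close> vanishes at \<open>w\<close>.\<close>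

lemma rayleigh_max_eigenvalue:
  fixes M :: "'a \<Rightarrow> 'a \<Rightarrow> real"
  assumes fin: "finite V" and ne: "V \<noteq> {}" and sym: "\<And>u v. M u v = M v u"
  shows "\<exists>k z. (\<exists>v\<in>V. z v \<noteq> 0) \<and> (\<forall>v\<in>V. (\<Sum>u\<in>V. M v u * z u) = k * z v) \<and>
    (\<forall>x. (\<Sum>u\<in>V. \<Sum>v\<in>V. M u v * x u * x v) \<le> k * (\<Sum>v\<in>V. (x v)\<^sup>2))"
proof -
  define Q where "Q x = (\<Sum>u\<in>V. \<Sum>v\<in>V. M u v * x u * x v)" for x
  define N :: "('a \<Rightarrow> real) \<Rightarrow> real" where "N x = (\<Sum>v\<in>V. (x v)\<^sup>2)" for x
  obtain z where z: "N z = 1" "\<And>x. N x = 1 \<Longrightarrow> Q x \<le> Q z"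
    using quadratic_form_max_on_sphere[OF fin ne, of M] unfolding Q_def N_def by blast
  define k where "k = Q z"
  have scale: "Q (\<lambda>v. c * x v) = c\<^sup>2 * Q x" "N (\<lambda>v. c * x v) = c\<^sup>2 * N x" for c x
    by (simp_all add: Q_def N_def sum_distrib_left power2_eq_square mult_ac)
  have le: "Q x \<le> k * N x" for x
  proof (cases "N x = 0")
    case True
    then have "\<forall>v\<in>V. x v = 0"
      using fin by (simp add: N_def sum_nonneg_eq_0_iff)
    then have "Q x = 0" by (simp add: Q_def)
    then show ?thesis using True by simp
  next
    case False
    moreover have "N x \<ge> 0" by (simp add: N_def sum_nonneg)
    ultimately have pos: "N x > 0" by simp
    define c where "c = 1 / sqrt (N x)"
    have c2: "c\<^sup>2 * N x = 1" using pos by (simp add: c_def power_divide)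
    then have "c\<^sup>2 * Q x \<le> k * (c\<^sup>2 * N x)"
      using z(2)[of "\<lambda>v. c * x v"] by (simp add: scale k_def)
    then have "c\<^sup>2 * Q x \<le> c\<^sup>2 * (k * N x)" by (simp add: mult_ac)
    moreover have "c\<^sup>2 > 0" using pos by (simp add: c_def)
    ultimately show ?thesis by simp
  qed
  have eig: "(\<Sum>u\<in>V. M w u * z u) = k * z w" if w: "w \<in> V" for w
  proof -
    define R where "R = (\<Sum>u\<in>V. M w u * z u) - k * z w"
    define e where "e v = (if v = w then 1 else 0::real)" for v
    have Qt: "Q (\<lambda>v. z v + t * e v) = Q z + 2 * t * (\<Sum>u\<in>V. M w u * z u) + t\<^sup>2 * M w w" for t
    proof -
      have "Q (\<lambda>v. z v + t * e v) = (\<Sum>u\<in>V. \<Sum>v\<in>V. M u v * z u * z v)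
        + t * (\<Sum>u\<in>V. \<Sum>v\<in>V. M u v * z u * e v) + t * (\<Sum>u\<in>V. \<Sum>v\<in>V. M u v * e u * z v)
        + t\<^sup>2 * (\<Sum>u\<in>V. \<Sum>v\<in>V. M u v * e u * e v)"
        unfolding Q_def sum_distrib_left sum.distrib[symmetric]
        by (intro sum.cong refl) (simp add: algebra_simps power2_eq_square)
      also have "(\<Sum>u\<in>V. \<Sum>v\<in>V. M u v * z u * e v) = (\<Sum>u\<in>V. M w u * z u)"
        using w fin sym by (simp add: e_def if_distrib[of "\<lambda>t. _ * t"] cong: if_cong)
      also have "(\<Sum>u\<in>V. \<Sum>v\<in>V. M u v * e u * z v) = (\<Sum>u\<in>V. M w u * z u)"
        using w fin by (subst sum.swap)
          (simp add: e_def if_distrib[of "\<lambda>t. _ * t"] if_distrib[of "\<lambda>t. t * _"] cong: if_cong)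
      also have "(\<Sum>u\<in>V. \<Sum>v\<in>V. M u v * e u * e v) = M w w"
        using w fin by (simp add: e_def if_distrib[of "\<lambda>t. _ * t"] cong: if_cong)
      finally show ?thesis by (simp add: Q_def)
    qed
    have Nt: "N (\<lambda>v. z v + t * e v) = N z + 2 * t * z w + t\<^sup>2" for t
    proof -
      have "N (\<lambda>v. z v + t * e v) = N z + 2 * t * (\<Sum>v\<in>V. z v * e v) + t\<^sup>2 * (\<Sum>v\<in>V. e v * e v)"
        unfolding N_def sum_distrib_left sum.distrib[symmetric]
        by (intro sum.cong refl) (simp add: algebra_simps power2_eq_square)
      also have "\<dots> = N z + 2 * t * z w + t\<^sup>2"
        using w fin by (simp add: e_def if_distrib[of "\<lambda>t. _ * t"] cong: if_cong)
      finally show ?thesis .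
    qed
    have ineq: "2 * t * R + t\<^sup>2 * (M w w - k) \<le> 0" for t
    proof -
      have "Q z + 2 * t * (\<Sum>u\<in>V. M w u * z u) + t\<^sup>2 * M w w \<le> k * (N z + 2 * t * z w + t\<^sup>2)"
        using le[of "\<lambda>v. z v + t * e v"] unfolding Qt Nt .
      then show ?thesis using z(1) by (simp add: R_def k_def algebra_simps)
    qed
    have "R = 0"
    proof (rule ccontr)
      assume R: "R \<noteq> 0"
      \<comment> \<open>As \<open>B\<close> exceeds the absolute value of the quadratic coefficient,
        \<open>t = R / B\<close> leaves at least \<open>R\<^sup>2 / B\<close>. The summand 1 keeps
        \<open>B\<close> positive when that coefficient is 0.\<close>
      define B where "B = \<bar>M w w - k\<bar> + 1"
      have B: "B > 0" "- B \<le> M w w - k" by (auto simp: B_def)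
      have "2 * (R / B) * R + (R / B)\<^sup>2 * (M w w - k) \<ge> 2 * (R / B) * R + (R / B)\<^sup>2 * (- B)"
        using B(2) by (intro add_left_mono mult_left_mono) auto
      also have "2 * (R / B) * R + (R / B)\<^sup>2 * (- B) = R\<^sup>2 / B"
        using B(1) by (simp add: power2_eq_square field_simps)
      finally have "R\<^sup>2 / B \<le> 0" using ineq[of "R / B"] by linarith
      moreover have "R\<^sup>2 / B > 0" using R B(1) by simp
      ultimately show False by simp
    qed
    then show ?thesis by (simp add: R_def)
  qed
  have "\<exists>v\<in>V. z v \<noteq> 0"
  proof (rule ccontr)
    assume "\<not> ?thesis"
    then have "N z = 0" by (simp add: N_def)
    then show False using z(1) by simp
  qed
  then show ?thesis
    using eig le unfolding Q_def N_def by (intro exI[of _ k] exI[of _ z]) blast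
qed

text \<open>The maximal Rayleigh quotient is an eigenvalue, hence at most \<open>Q_index H\<close>:
  the set under \<open>Max\<close> is finite, being the roots of the characteristic
  polynomial.\<close>

lemma Q_index_rayleigh:
  assumes fin: "finite (pverts H)" and ne: "pverts H \<noteq> {}" and sym: "sym (parcs H)"
  shows "(\<Sum>v\<in>pverts H. real (out_degree (with_proj H) v) * (x v)\<^sup>2)
      + (\<Sum>u\<in>pverts H. \<Sum>v\<in>pverts H. if (u, v) \<in> parcs H then x u * x v else 0)
    \<le> Q_index H * (\<Sum>v\<in>pverts H. (x v)\<^sup>2)"
proof -
  let ?V = "pverts H" and ?S = "signless_laplacian H (vertex_enum H)"
  define d where "d v = real (out_degree (with_proj H) v)" for v
  define M where "M u v = (if u = v then d u else 0) + (if (u, v) \<in> parcs H then 1 else 0)" for u v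
  have M_sym: "M u v = M v u" for u v
    using sym by (auto simp: M_def sym_def)
  obtain k z where nz: "\<exists>v\<in>?V. z v \<noteq> 0"
    and eig: "\<And>v. v \<in> ?V \<Longrightarrow> (\<Sum>u\<in>?V. M v u * z u) = k * z v"
    and le: "\<And>x. (\<Sum>u\<in>?V. \<Sum>v\<in>?V. M u v * x u * x v) \<le> k * (\<Sum>v\<in>?V. (x v)\<^sup>2)"
    using rayleigh_max_eigenvalue[OF fin ne, of M, OF M_sym] by blast
  have row: "(\<Sum>u\<in>?V. M v u * y u) = d v * y v + (\<Sum>u\<in>?V. if (v, u) \<in> parcs H then y u else 0)"
    if "v \<in> ?V" for v y
  proof -
    have "(\<Sum>u\<in>?V. M v u * y u)
      = (\<Sum>u\<in>?V. (if v = u then d v * y v else 0) + (if (v, u) \<in> parcs H then y u else 0))"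
      by (intro sum.cong) (auto simp: M_def algebra_simps)
    then show ?thesis using that fin by (simp add: sum.distrib)
  qed
  have "eigenvalue ?S k"
    using nz eig row by (subst eigenvalue_signless_laplacian_iff[OF vertex_enum[OF fin]])
      (auto simp: d_def)
  moreover have "finite {k. eigenvalue ?S k}"
  proof -
    have S: "?S \<in> carrier_mat (length (vertex_enum H)) (length (vertex_enum H))"
      by (simp add: signless_laplacian_def degree_matrix_def adjacency_matrix_def)
    have "char_poly ?S \<noteq> 0"
      using degree_monic_char_poly[OF S] by auto
    then show ?thesis
      using poly_roots_finite by (simp add: eigenvalue_root_char_poly[OF S])
  qed
  ultimately have k: "k \<le> Q_index H"
    unfolding Q_index_def by simp
  have "(\<Sum>v\<in>?V. d v * (x v)\<^sup>2) + (\<Sum>u\<in>?V. \<Sum>v\<in>?V. if (u, v) \<in> parcs H then x u * x v else 0)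
    = (\<Sum>u\<in>?V. x u * (\<Sum>v\<in>?V. M u v * x v))"
    unfolding sum.distrib[symmetric]
    by (intro sum.cong refl, subst row) (auto simp: distrib_left sum_distrib_left power2_eq_square
      mult_ac intro!: sum.cong)
  also have "\<dots> = (\<Sum>u\<in>?V. \<Sum>v\<in>?V. M u v * x u * x v)"
    by (simp add: sum_distrib_left mult_ac)
  also have "\<dots> \<le> k * (\<Sum>v\<in>?V. (x v)\<^sup>2)" by (rule le)
  also have "\<dots> \<le> Q_index H * (\<Sum>v\<in>?V. (x v)\<^sup>2)"
    using k by (intro mult_right_mono sum_nonneg) auto
  finally show ?thesis by (simp add: d_def)
qed

section \<open>The complement and a weighted Mantel theorem\<close>

lemma sum_arcs_swap:
  assumes "sym E"
  shows "(\<Sum>(u, v)\<in>E. f u v) = (\<Sum>(u, v)\<in>E. f v u)"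
proof -
  have "bij_betw prod.swap E E"
    using assms by (intro bij_betw_byWitness[where f' = prod.swap]) (auto dest: symD)
  from sum.reindex_bij_betw[OF this, of "\<lambda>(u, v). f u v"]
  show ?thesis by (simp add: case_prod_unfold)
qed

lemma out_degree_with_proj: "out_degree (with_proj H) u = card (parcs H `` {u})"
proof -
  have "out_arcs (with_proj H) u = Pair u ` (parcs H `` {u})" by auto
  then show ?thesis by (simp add: out_degree_def card_image inj_on_def)
qed

lemma signless_form_conv_arcs:
  fixes x :: "'a \<Rightarrow> real"
  assumes fin: "finite (pverts H)" and sub: "parcs H \<subseteq> pverts H \<times> pverts H"
    and sym: "sym (parcs H)"
  shows "(\<Sum>v\<in>pverts H. real (out_degree (with_proj H) v) * (x v)\<^sup>2)
      + (\<Sum>u\<in>pverts H. \<Sum>v\<in>pverts H. if (u, v) \<in> parcs H then x u * x v else 0)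
    = (\<Sum>(u, v)\<in>parcs H. (x u + x v)\<^sup>2) / 2"
proof -
  let ?V = "pverts H" and ?E = "parcs H"
  have E: "?E = Sigma ?V (\<lambda>u. ?E `` {u})" using sub by auto
  have finE: "finite (?E `` {u})" for u
    by (rule finite_subset[OF _ fin]) (use sub in auto)
  have "(\<Sum>v\<in>?V. real (out_degree (with_proj H) v) * (x v)\<^sup>2)
    = (\<Sum>(u, v)\<in>?E. (x u)\<^sup>2)"
    by (subst E) (simp add: out_degree_with_proj sum.Sigma[symmetric] fin finE)
  moreover have "(\<Sum>(u, v)\<in>?E. (x u)\<^sup>2) = (\<Sum>(u, v)\<in>?E. (x v)\<^sup>2)"
    by (rule sum_arcs_swap[OF sym])
  moreover have "(\<Sum>u\<in>?V. \<Sum>v\<in>?V. if (u, v) \<in> ?E then x u * x v else 0)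
    = (\<Sum>(u, v)\<in>?E. x u * x v)"
  proof -
    have "(\<Sum>v\<in>?V. if (u, v) \<in> ?E then x u * x v else 0) = (\<Sum>v\<in>?E `` {u}. x u * x v)" for u
    proof -
      have "?E `` {u} = {v \<in> ?V. (u, v) \<in> ?E}" using sub by auto
      then show ?thesis by (simp add: sum.inter_filter[OF fin])
    qed
    then show ?thesis
      by (subst (2) E) (simp add: sum.Sigma[symmetric] fin finE)
  qed
  moreover have "(\<Sum>(u, v)\<in>?E. (x u + x v)\<^sup>2)
    = (\<Sum>(u, v)\<in>?E. (x u)\<^sup>2) + (\<Sum>(u, v)\<in>?E. (x v)\<^sup>2) + 2 * (\<Sum>(u, v)\<in>?E. x u * x v)"
    by (simp add: sum.distrib[symmetric] sum_distrib_left power2_sum case_prod_unfold mult.assoc)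
  ultimately show ?thesis by simp
qed

text \<open>All ordered pairs split into arcs of the complement, arcs of \<open>G\<close> and the
  diagonal. The diagonal contributes four times the sum of squares, which after halving turns
  \<open>n\<close> into \<open>n - 2\<close>.\<close>

lemma Q_index_complement_rayleigh:
  fixes x :: "'a \<Rightarrow> real"
  assumes fin: "finite (pverts G)" and ne: "pverts G \<noteq> {}"
    and sub: "parcs G \<subseteq> pverts G \<times> pverts G" and sym: "sym (parcs G)"
    and irr: "\<And>v. (v, v) \<notin> parcs G"
  shows "(real (card (pverts G)) - 2) * (\<Sum>v\<in>pverts G. (x v)\<^sup>2) + (\<Sum>v\<in>pverts G. x v)\<^sup>2
      - (\<Sum>(u, v)\<in>parcs G. (x u + x v)\<^sup>2) / 2
    \<le> Q_index (complement_graph G) * (\<Sum>v\<in>pverts G. (x v)\<^sup>2)"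
proof -
  let ?V = "pverts G" and ?E = "parcs G"
  let ?H = "complement_graph G"
  define f where "f = (\<lambda>(u, v). (x u + x v)\<^sup>2)"
  define D where "D = (\<lambda>v. (v, v)) ` ?V"
  have V: "pverts ?H = ?V" and E: "parcs ?H = ?V \<times> ?V - (?E \<union> D)"
    by (auto simp: complement_graph_def D_def)
  have symH: "sym (parcs ?H)" using sym by (auto simp: complement_graph_def sym_def)
  have finE: "finite ?E" using fin sub by (meson finite_SigmaI finite_subset)
  have "sum f (?V \<times> ?V) = sum f (parcs ?H) + sum f (?E \<union> D)"
    unfolding E using sub fin by (intro sum.subset_diff) (auto simp: D_def)
  also have "sum f (?E \<union> D) = sum f ?E + sum f D"
    using irr fin finE by (intro sum.union_disjoint) (auto simp: D_def)
  also have "sum f D = 4 * (\<Sum>v\<in>?V. (x v)\<^sup>2)"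
    unfolding D_def by (subst sum.reindex) (auto simp: inj_on_def f_def power2_eq_square
        sum_distrib_left algebra_simps intro!: sum.cong)
  also have "sum f (?V \<times> ?V) = 2 * card ?V * (\<Sum>v\<in>?V. (x v)\<^sup>2) + 2 * (\<Sum>v\<in>?V. x v)\<^sup>2"
  proof -
    have "sum f (?V \<times> ?V) = (\<Sum>u\<in>?V. \<Sum>v\<in>?V. (x u)\<^sup>2 + (x v)\<^sup>2 + 2 * (x u * x v))"
      by (simp add: sum.cartesian_product f_def power2_sum algebra_simps)
    also have "\<dots> = 2 * card ?V * (\<Sum>v\<in>?V. (x v)\<^sup>2) + 2 * (\<Sum>u\<in>?V. \<Sum>v\<in>?V. x u * x v)"
      by (simp add: sum.distrib sum_distrib_left[symmetric])
    also have "(\<Sum>u\<in>?V. \<Sum>v\<in>?V. x u * x v) = (\<Sum>v\<in>?V. x v)\<^sup>2"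
      by (simp add: power2_eq_square sum_product)
    finally show ?thesis .
  qed
  finally have "sum f (parcs ?H) / 2 = (real (card ?V) - 2) * (\<Sum>v\<in>?V. (x v)\<^sup>2)
      + (\<Sum>v\<in>?V. x v)\<^sup>2 - sum f ?E / 2"
    by (simp add: algebra_simps)
  moreover have "sum f (parcs ?H) / 2 \<le> Q_index ?H * (\<Sum>v\<in>?V. (x v)\<^sup>2)"
    using Q_index_rayleigh[of ?H x] signless_form_conv_arcs[of ?H x] fin ne symH
    unfolding V f_def by (simp add: E)
  ultimately show ?thesis by (simp add: f_def)
qed

section \<open>Mantel's theorem with vertex weights\<close>

lemma sum_le_sum_add_sum:
  fixes f :: "'b \<Rightarrow> real"
  assumes "finite A" "finite B" "S \<subseteq> A \<union> B" "\<And>x. x \<in> A \<union> B \<Longrightarrow> 0 \<le> f x"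
  shows "sum f S \<le> sum f A + sum f B"
proof -
  have "sum f S \<le> sum f (A \<union> B)" using assms by (intro sum_mono2) auto
  also have "\<dots> \<le> sum f (A \<union> B) + sum f (A \<inter> B)" using assms by (auto intro: sum_nonneg)
  also have "\<dots> = sum f A + sum f B" using assms by (simp add: sum.union_inter)
  finally show ?thesis .
qed

text \<open>Every arc leaves the complement of a heaviest independent set \<open>I\<close> at one of its ends, and a
  neighbourhood, being independent, weighs at most as much as \<open>I\<close>.\<close>

lemma weighted_mantel:
  fixes w :: "'a \<Rightarrow> real"
  assumes fin: "finite A" and sym: "sym E"
    and tf: "\<And>u v w. (u, v) \<in> E \<Longrightarrow> (v, w) \<in> E \<Longrightarrow> (w, u) \<notin> E"
    and w: "\<And>v. v \<in> A \<Longrightarrow> 0 \<le> w v"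
  shows "(\<Sum>(u, v)\<in>E \<inter> A \<times> A. w u * w v) \<le> (sum w A)\<^sup>2 / 2"
proof -
  define \<I> where "\<I> = {I. I \<subseteq> A \<and> E \<inter> I \<times> I = {}}"
  have "finite \<I>" using fin by (auto simp: \<I>_def)
  moreover have "{} \<in> \<I>" by (simp add: \<I>_def)
  ultimately obtain I where I: "I \<in> \<I>" and "sum w I = Max (sum w ` \<I>)"
    by (metis (mono_tags, lifting) Max_in empty_iff finite_imageI image_iff image_is_empty)
  with \<open>finite \<I>\<close> have I_max: "sum w J \<le> sum w I" if "J \<in> \<I>" for J
    using that by simp
  have IA: "I \<subseteq> A" and indep: "E \<inter> I \<times> I = {}" using I by (auto simp: \<I>_def)
  have finN: "finite (E `` {u} \<inter> A)" for u using fin by simp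
  let ?S = "Sigma (A - I) (\<lambda>u. E `` {u} \<inter> A)" and ?f = "\<lambda>(u, v). w u * w v"
  have S: "sum ?f ?S \<le> sum w I * (sum w A - sum w I)"
  proof -
    have "sum ?f ?S = (\<Sum>u\<in>A - I. w u * sum w (E `` {u} \<inter> A))"
      using fin finN by (simp add: sum.Sigma[symmetric] sum_distrib_left)
    also have "\<dots> \<le> (\<Sum>u\<in>A - I. w u * sum w I)"
    proof (intro sum_mono mult_left_mono I_max)
      fix u
      show "E `` {u} \<inter> A \<in> \<I>"
        using tf sym by (auto simp: \<I>_def dest: symD)
    qed (use w in auto)
    also have "\<dots> = sum w I * (sum w A - sum w I)"
      using fin IA by (simp add: sum_distrib_right[symmetric] sum_diff mult.commute)
    finally show ?thesis .
  qed
  have finS: "finite ?S" using fin by simp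
  have "sum ?f (E \<inter> A \<times> A) \<le> sum ?f ?S + sum ?f (prod.swap ` ?S)"
  proof (rule sum_le_sum_add_sum)
    show "E \<inter> A \<times> A \<subseteq> ?S \<union> prod.swap ` ?S"
      using indep sym by (force simp: image_iff dest: symD)
  qed (use finS w in auto)
  also have "sum ?f (prod.swap ` ?S) = sum ?f ?S"
    by (subst sum.reindex) (auto simp: case_prod_unfold mult.commute intro!: sum.cong)
  also have "sum ?f ?S + sum ?f ?S \<le> 2 * (sum w I * (sum w A - sum w I))"
    using S by simp
  also have "\<dots> \<le> (sum w A)\<^sup>2 / 2"
    using zero_le_power2[of "sum w A - 2 * sum w I"] by (simp add: power2_eq_square algebra_simps)
  finally show ?thesis .
qed

section \<open>Numerical inequalities\<close>

text \<open>Two estimates of the remainder of \<open>(n - \<delta>)\<^sup>2\<close> modulo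
  \<open>n\<close>: it is at most \<open>n - 1\<close>, and at most \<open>\<delta>\<^sup>2\<close>
  because \<open>(n - \<delta>)\<^sup>2 = n * (n - 2 * \<delta>) + \<delta>\<^sup>2\<close>. The
  integer \<open>n - 2 * \<delta>\<close> may be negative, hence the comparison in
  \<open>int\<close>.\<close>

lemma quotient_bounds:
  fixes n \<delta> :: nat
  defines "F \<equiv> 4 * (real \<delta>)\<^sup>2 / real n + real_of_int \<lfloor>(real n - real \<delta>)\<^sup>2 / real n\<rfloor>"
  assumes "\<delta> < n"
  shows "4 * (real \<delta>)\<^sup>2 + (real n - real \<delta>)\<^sup>2 - (real n - 1) \<le> real n * F"
    and "4 * (real \<delta>)\<^sup>2 + (real n - real \<delta>)\<^sup>2 - (real \<delta>)\<^sup>2 \<le> real n * F"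
proof -
  define p where "p = (n - \<delta>)\<^sup>2"
  have p: "(real n - real \<delta>)\<^sup>2 = real p"
    using assms by (simp add: p_def of_nat_diff)
  have n: "real n > 0" using assms by simp
  have "\<lfloor>(real n - real \<delta>)\<^sup>2 / real n\<rfloor> = int (p div n)"
    unfolding p by (simp add: floor_divide_of_nat_eq)
  then have F: "real n * F = 4 * (real \<delta>)\<^sup>2 + real (n * (p div n))"
    using n by (simp add: F_def algebra_simps)
  have "n * (p div n) + p mod n = p" "p mod n < n" using assms by simp_all
  then have "real p - (real n - 1) \<le> real (n * (p div n))" by linarith
  then show "4 * (real \<delta>)\<^sup>2 + (real n - real \<delta>)\<^sup>2 - (real n - 1) \<le> real n * F"
    using F p by linarith
  have "real n - 2 * real \<delta> = real_of_int (int n - 2 * int \<delta>)" by simp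
  also have "\<dots> \<le> real_of_int \<lfloor>real p / real n\<rfloor>"
  proof -
    have "(real n - 2 * real \<delta>) * real n \<le> real p"
      unfolding p[symmetric] by (simp add: power2_eq_square algebra_simps)
    then have "real_of_int (int n - 2 * int \<delta>) \<le> real p / real n"
      using n by (simp add: le_divide_eq)
    then show ?thesis by (simp only: of_int_le_iff le_floor_iff)
  qed
  finally have "real n * (real n - 2 * real \<delta>) \<le> real n * real (p div n)"
    using n by (simp add: floor_divide_of_nat_eq)
  then show "4 * (real \<delta>)\<^sup>2 + (real n - real \<delta>)\<^sup>2 - (real \<delta>)\<^sup>2 \<le> real n * F"
    using F by (simp add: power2_eq_square algebra_simps)
qed

text \<open>Convexity: for a fixed sum, the squares are largest when one term sits at its lower
  bound.\<close>

lemma sum_squares_le: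
  fixes A B l :: real
  assumes "l \<le> A" "l \<le> B"
  shows "A\<^sup>2 + B\<^sup>2 \<le> l\<^sup>2 + (A + B - l)\<^sup>2"
proof -
  have "0 \<le> (A - l) * (B - l)" using assms by simp
  then show ?thesis by (simp add: power2_eq_square algebra_simps)
qed

text \<open>The numerical inequality for the test vector \<open>1/2\<close> on the cut; the positive combinations in its
  proof come from writing \<open>n = 3 d + 2 + w\<close>, where \<open>0 \<le> w \<le> 3 d - 1\<close>, and \<open>d = 4 + e\<close>. The
  alternatives for \<open>r\<close> are the two bounds on \<open>(n - d)\<^sup>2 mod n\<close>.\<close>

lemma halved_cut_inequality:
  fixes n d r :: real
  assumes "(d = 2 \<and> r = d\<^sup>2) \<or> (d = 3 \<and> r = d\<^sup>2) \<or> (4 \<le> d \<and> r = n - 1)"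
    and "3 * d + 2 \<le> n" "n \<le> 6 * d + 1"
  shows "n\<^sup>2 * (n - 3/4 * d) + n * ((n - d - 1)\<^sup>2 + (2 * d + 1)\<^sup>2 - 7/8 * d * (n + d) + 49/128 * d\<^sup>2)
    < (4 * d\<^sup>2 + (n - d)\<^sup>2 - r) * (n - 3/4 * d) + n * (n - d / 2)\<^sup>2" (is "?l < ?r")
proof -
  define w where "w = n - (3 * d + 2)"
  have n: "n = 3 * d + 2 + w" and w: "0 \<le> w" "w \<le> 3 * d - 1" using assms by (simp_all add: w_def)
  from assms(1) show ?thesis
  proof (elim disjE conjE)
    assume d: "d = 2" "r = d\<^sup>2"
    have "?r - ?l = 63/4 + 607/32 * w + 7/4 * w\<^sup>2"
      unfolding d n by (simp add: power2_eq_square field_simps)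
    moreover have "0 \<le> w\<^sup>2" by simp
    ultimately show ?thesis using w by linarith
  next
    assume d: "d = 3" "r = d\<^sup>2"
    have "?r - ?l = 2381/128 + 3447/128 * w + 13/8 * w\<^sup>2"
      unfolding d n by (simp add: power2_eq_square field_simps)
    moreover have "0 \<le> w\<^sup>2" by simp
    ultimately show ?thesis using w by linarith
  next
    assume d: "4 \<le> d" "r = n - 1"
    define e where "e = d - 4"
    have e: "d = 4 + e" "0 \<le> e" using d by (simp_all add: e_def)
    \<comment> \<open>The total coefficient of \<open>w\<^sup>2\<close> is \<open>1 - d / 8\<close>,
      negative for large \<open>d\<close>; the last product absorbs it by means of the upper bound
      on \<open>w\<close>.\<close>
    have "?r - ?l = (197/4 + 56 * e + 1181/64 * e^2 + 237/128 * e^3)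
      + (179/8 + 149/16 * e + 143/128 * e^2) * w + w\<^sup>2 + d / 8 * (w * (3 * d - 1 - w))"
      unfolding d(2) n unfolding e(1)
      by (simp add: power2_eq_square power3_eq_cube field_simps)
    moreover have "0 \<le> d / 8 * (w * (3 * d - 1 - w))" using d w by simp
    moreover have "0 \<le> (179/8 + 149/16 * e + 143/128 * e^2) * w" using e w by simp
    moreover have "0 < 197/4 + 56 * e + 1181/64 * e^2 + 237/128 * e^3"
      using e by (intro add_pos_nonneg) simp_all
    moreover have "0 \<le> w\<^sup>2" by simp
    ultimately show ?thesis by linarith
  qed
qed

text \<open>For the test vector \<open>3/2\<close> on \<open>X\<close>, with \<open>s\<close> the
  number of arcs inside \<open>X\<close>. The left side decreases in \<open>s\<close>, so the least
  \<open>s\<close> suffices; the difference is then a polynomial with positive coefficients in the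
  excess variables.\<close>

lemma raised_part_inequality:
  fixes n d r s :: real
  assumes "(d = 2 \<and> r = d\<^sup>2 \<and> 2 \<le> s) \<or> (d = 3 \<and> 10 \<le> n \<and> r = d\<^sup>2 \<and> 4 \<le> s)
      \<or> (d = 3 \<and> n = 9 \<and> r = n - 1 \<and> 4 \<le> s) \<or> (4 \<le> d \<and> r = n - 1 \<and> d \<le> s)"
    and "3 * d \<le> n"
  shows "n\<^sup>2 * (n + 5/4 * d) + n * ((n - d)\<^sup>2 + 25/4 * d\<^sup>2 - 7/4 * s)
    < (4 * d\<^sup>2 + (n - d)\<^sup>2 - r) * (n + 5/4 * d) + n * (n + d / 2)\<^sup>2" (is "?l s < ?r")
proof -
  have mono: "?l s \<le> ?l s'" if "s' \<le> s" for s'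
    using that assms(2) assms(1) by (intro add_mono mult_left_mono) auto
  define w where "w = n - 3 * d"
  have n: "n = 3 * d + w" and w: "0 \<le> w" using assms by (simp_all add: w_def)
  from assms(1) show ?thesis
  proof (elim disjE conjE)
    assume d: "d = 2" "r = d\<^sup>2" "2 \<le> s"
    have "?r - ?l 2 = 1 + 11/2 * w + 2 * w\<^sup>2"
      unfolding d n by (simp add: power2_eq_square field_simps)
    moreover have "0 \<le> w\<^sup>2" by simp
    ultimately show ?thesis using w mono[OF d(3)] by linarith
  next
    assume d: "d = 3" "10 \<le> n" "r = d\<^sup>2" "4 \<le> s"
    define v where "v = n - 10"
    have v: "n = 10 + v" "0 \<le> v" using d by (simp_all add: v_def)
    have "?r - ?l 4 = 10 + 35/2 * v + 3 * v\<^sup>2"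
      unfolding d(1,3) v(1) by (simp add: power2_eq_square field_simps)
    moreover have "0 \<le> v\<^sup>2" by simp
    ultimately show ?thesis using v mono[OF d(4)] by linarith
  next
    \<comment> \<open>At \<open>n = 9\<close> the choice \<open>r = d\<^sup>2\<close> would give
      \<open>- 9/2\<close>; the sharper \<open>r = n - 1\<close> is what rescues this case.\<close>
    assume d: "d = 3" "n = 9" "r = n - 1" "4 \<le> s"
    have "?r - ?l 4 = 33/4" unfolding d by (simp add: power2_eq_square)
    then show ?thesis using mono[OF d(4)] by linarith
  next
    assume d: "4 \<le> d" "r = n - 1" "d \<le> s"
    define e where "e = d - 4"
    have e: "d = 4 + e" "0 \<le> e" using d by (simp_all add: e_def)
    have "?r - ?l d = (9 + 113/4 * e + 27/2 * e^2 + 7/4 * e^3)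
      + (3 + 13/2 * e + 3/2 * e^2) * w + (3 + e) * w\<^sup>2"
      unfolding d(2) n unfolding e(1)
      by (simp add: power2_eq_square power3_eq_cube field_simps)
    moreover have "0 \<le> (3 + 13/2 * e + 3/2 * e^2) * w" "0 \<le> (3 + e) * w\<^sup>2" using e w by simp_all
    moreover have "0 < 9 + 113/4 * e + 27/2 * e^2 + 7/4 * e^3"
      using e by (intro add_pos_nonneg) simp_all
    ultimately show ?thesis using mono[OF d(3)] by linarith
  qed
qed

section \<open>Separations of a triangle-free graph\<close>

text \<open>What a cut violating super-\<kappa> provides. \<open>inner_neighbour\<close> records
  that no vertex is isolated, and the conditions are symmetric in \<open>X\<close> and
  \<open>Y\<close>, so each bound transfers by \<open>swapped\<close>.\<close>

locale separation =
  fixes E :: "('a \<times> 'a) set" and X Y C :: "'a set" and \<delta> :: nat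
  assumes finite_parts: "finite X" "finite Y" "finite C"
    and disjoint_parts: "X \<inter> Y = {}" "X \<inter> C = {}" "Y \<inter> C = {}"
    and arcs: "E \<subseteq> (X \<union> C) \<times> (X \<union> C) \<union> (Y \<union> C) \<times> (Y \<union> C)"
    and sym_arcs: "sym E"
    and no_triangle: "\<And>u v w. (u, v) \<in> E \<Longrightarrow> (v, w) \<in> E \<Longrightarrow> (w, u) \<notin> E"
    and degree_ge: "\<And>v. v \<in> X \<union> Y \<union> C \<Longrightarrow> \<delta> \<le> card (E `` {v})"
    and nonempty_parts: "X \<noteq> {}" "Y \<noteq> {}"
    and inner_neighbour: "\<And>u. u \<in> X \<Longrightarrow> \<exists>v\<in>X. (u, v) \<in> E" "\<And>u. u \<in> Y \<Longrightarrow> \<exists>v\<in>Y. (u, v) \<in> E"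
    and card_cut_le: "card C \<le> \<delta>"
begin

lemma swapped: "separation E Y X C \<delta>"
  by (unfold_locales; (fact finite_parts sym_arcs nonempty_parts card_cut_le inner_neighbour no_triangle
    | use disjoint_parts arcs degree_ge in blast))

lemma no_loop: "(v, v) \<notin> E"
  using no_triangle by blast

lemma finite_arcs: "finite E"
  by (rule finite_subset[OF arcs]) (use finite_parts in simp)

lemma sum_parts:
  fixes f :: "'a \<Rightarrow> real"
  shows "sum f (X \<union> Y \<union> C) = sum f X + sum f Y + sum f C"
    and "sum f (X \<union> C) = sum f X + sum f C" and "sum f (Y \<union> C) = sum f Y + sum f C"
  using finite_parts disjoint_parts by (simp_all add: sum.union_disjoint Int_Un_distrib2)

lemma edge_neighbours:
  assumes "x \<in> X" "y \<in> X" "(x, y) \<in> E"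
  shows "card (E `` {x}) + card (E `` {y}) \<le> card X + card C"
proof -
  have "E `` {x} \<inter> E `` {y} = {}"
    using no_triangle[OF assms(3)] sym_arcs by (auto dest: symD)
  moreover have sub: "E `` {x} \<union> E `` {y} \<subseteq> X \<union> C"
    using arcs disjoint_parts assms by blast
  moreover have "finite (E `` {x})" "finite (E `` {y})"
    using finite_arcs by simp_all
  ultimately have "card (E `` {x}) + card (E `` {y}) = card (E `` {x} \<union> E `` {y})"
    by (simp add: card_Un_disjoint)
  also have "\<dots> \<le> card (X \<union> C)" using sub finite_parts by (simp add: card_mono)
  also have "\<dots> = card X + card C"
    using finite_parts disjoint_parts by (simp add: card_Un_disjoint)
  finally show ?thesis .
qed

lemma part_card_ge: "2 * \<delta> \<le> card X + card C"
proof -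
  obtain x y where "x \<in> X" "y \<in> X" "(x, y) \<in> E" using nonempty_parts(1) inner_neighbour(1) by blast
  then show ?thesis
    using edge_neighbours[of x y] degree_ge[of x] degree_ge[of y] by simp
qed

text \<open>With \<open>f u v = (x u + x v)\<^sup>2 / 2\<close> and \<open>x\<close> equal to \<open>1 - s\<close> on \<open>C\<close> and \<open>1\<close> elsewhere, the right
  weight is \<open>w = (1 - s / 2)\<^sup>2\<close> on \<open>C\<close>, which makes the bound on \<open>f\<close> sharp between \<open>X\<close> and \<open>C\<close>.\<close>

lemma weighted_arc_bound:
  fixes w :: "'a \<Rightarrow> real"
  assumes w: "\<And>v. 0 \<le> w v" and f: "\<And>u v. (u, v) \<in> E \<Longrightarrow> f u v \<le> 2 * (w u * w v)"
  shows "(\<Sum>(u, v)\<in>E. f u v) \<le> (sum w X + sum w C)\<^sup>2 + (sum w Y + sum w C)\<^sup>2"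
proof -
  let ?g = "\<lambda>(u, v). w u * w v"
  have "(\<Sum>(u, v)\<in>E. f u v) \<le> 2 * sum ?g E"
    unfolding sum_distrib_left by (intro sum_mono) (use f in auto)
  also have "sum ?g E \<le> sum ?g (E \<inter> (X \<union> C) \<times> (X \<union> C)) + sum ?g (E \<inter> (Y \<union> C) \<times> (Y \<union> C))"
    by (rule sum_le_sum_add_sum) (use finite_arcs arcs w in auto)
  also have "\<dots> \<le> (sum w (X \<union> C))\<^sup>2 / 2 + (sum w (Y \<union> C))\<^sup>2 / 2"
    by (intro add_mono weighted_mantel[OF _ sym_arcs no_triangle w]) (use finite_parts in simp_all)
  finally show ?thesis by (simp add: sum_parts)
qed

context
  fixes n :: nat
  defines "n \<equiv> card X + card Y + card C"
begin

text \<open>The constants are those of the test vector that is \<open>3/2\<close> on \<open>X\<close> and \<open>1\<close> elsewhere: when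
  \<open>card X = card C = \<delta>\<close>, every vertex of \<open>X\<close> has degree exactly \<open>\<delta>\<close>, so the arcs meeting \<open>X\<close>
  can be counted exactly and only the rest needs Mantel's bound.\<close>

lemma raised_part_arc_bound:
  assumes X: "card X = \<delta>" and C: "card C = \<delta>"
  shows "(\<Sum>(u, v)\<in>E. ((if u \<in> X then 3/2 else 1) + (if v \<in> X then 3/2 else 1 :: real))\<^sup>2) / 2
    \<le> (real n - real \<delta>)\<^sup>2 + 25/4 * (real \<delta>)\<^sup>2 - 7/4 * real (card (E \<inter> X \<times> X))"
proof -
  \<comment> \<open>The degrees at the ends of an edge inside \<open>X\<close> sum to at most
    \<open>2 * \<delta>\<close>, while each is at least \<open>\<delta>\<close>.\<close>
  have deg: "card (E `` {x}) = \<delta>" if x: "x \<in> X" for x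
  proof -
    obtain y where "y \<in> X" "(x, y) \<in> E" using inner_neighbour(1)[OF x] by blast
    then show ?thesis
      using edge_neighbours[of x y] degree_ge[of x] degree_ge[of y] x X C by simp
  qed
  let ?b = "\<lambda>P. if P then 1 else 0 :: real"
  have card_filter: "(\<Sum>(u, v)\<in>E. ?b (P u v)) = real (card {(u, v)\<in>E. P u v})" for P
  proof -
    have "{(u, v)\<in>E. P u v} = {e\<in>E. P (fst e) (snd e)}" by auto
    then show ?thesis
      using finite_arcs by (simp add: case_prod_unfold sum.If_cases Int_def)
  qed
  have out: "(\<Sum>(u, v)\<in>E. ?b (u \<in> X)) = (real \<delta>)\<^sup>2"
  proof -
    have "{(u, v)\<in>E. u \<in> X} = Sigma X (\<lambda>u. E `` {u})" by auto
    then show ?thesis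
      using finite_parts finite_arcs deg X by (simp add: card_filter power2_eq_square)
  qed
  have into: "(\<Sum>(u, v)\<in>E. ?b (v \<in> X)) = (real \<delta>)\<^sup>2"
    using out sum_arcs_swap[OF sym_arcs, of "\<lambda>u v. ?b (u \<in> X)"] by simp
  have both: "(\<Sum>(u, v)\<in>E. ?b (u \<in> X \<and> v \<in> X)) = card (E \<inter> X \<times> X)"
    unfolding card_filter by (intro arg_cong[where f = "\<lambda>S. real (card S)"]) auto
  have rest: "(\<Sum>(u, v)\<in>E. ?b (u \<in> Y \<union> C \<and> v \<in> Y \<union> C)) \<le> (real n - real \<delta>)\<^sup>2 / 2"
  proof -
    have "(\<Sum>(u, v)\<in>E. ?b (u \<in> Y \<union> C \<and> v \<in> Y \<union> C)) = card (E \<inter> (Y \<union> C) \<times> (Y \<union> C))"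
      unfolding card_filter by (intro arg_cong[where f = "\<lambda>S. real (card S)"]) auto
    also have "\<dots> = (\<Sum>(u, v)\<in>E \<inter> (Y \<union> C) \<times> (Y \<union> C). 1 * 1)"
      by (simp add: case_prod_unfold)
    also have "\<dots> \<le> (\<Sum>v\<in>Y \<union> C. 1)\<^sup>2 / 2"
      by (rule weighted_mantel[OF _ sym_arcs no_triangle]) (use finite_parts in simp_all)
    also have "(\<Sum>v\<in>Y \<union> C. 1 :: real) = real n - real \<delta>"
      unfolding sum_parts by (simp add: n_def X)
    finally show ?thesis .
  qed
  \<comment> \<open>An arc contributes 2 outside \<open>X\<close>, 25/8 with one end in
    \<open>X\<close>, and 9/2 = 25/8 + 25/8 - 7/4 with both.\<close>
  have "(\<Sum>(u, v)\<in>E. ((if u \<in> X then 3/2 else 1) + (if v \<in> X then 3/2 else 1 :: real))\<^sup>2) / 2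
    = (\<Sum>(u, v)\<in>E. 2 * ?b (u \<in> Y \<union> C \<and> v \<in> Y \<union> C) + 25/8 * ?b (u \<in> X) + 25/8 * ?b (v \<in> X)
        - 7/4 * ?b (u \<in> X \<and> v \<in> X))"
    unfolding sum_divide_distrib
  proof (intro sum.cong refl, clarify)
    fix u v assume "(u, v) \<in> E"
    then have "u \<in> X \<union> Y \<union> C" "v \<in> X \<union> Y \<union> C" using arcs by auto
    then have "u \<in> Y \<union> C \<longleftrightarrow> u \<notin> X" "v \<in> Y \<union> C \<longleftrightarrow> v \<notin> X"
      using disjoint_parts by auto
    then show "((if u \<in> X then 3/2 else 1) + (if v \<in> X then 3/2 else 1 :: real))\<^sup>2 / 2
      = 2 * ?b (u \<in> Y \<union> C \<and> v \<in> Y \<union> C) + 25/8 * ?b (u \<in> X) + 25/8 * ?b (v \<in> X)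
        - 7/4 * ?b (u \<in> X \<and> v \<in> X)"
      by (simp add: power2_eq_square)
  qed
  also have "\<dots> = 2 * (\<Sum>(u, v)\<in>E. ?b (u \<in> Y \<union> C \<and> v \<in> Y \<union> C)) + 25/8 * (\<Sum>(u, v)\<in>E. ?b (u \<in> X))
    + 25/8 * (\<Sum>(u, v)\<in>E. ?b (v \<in> X)) - 7/4 * (\<Sum>(u, v)\<in>E. ?b (u \<in> X \<and> v \<in> X))"
    by (simp only: case_prod_unfold sum.distrib sum_subtractf sum_distrib_left)
  finally show ?thesis using rest unfolding out into both by simp
qed

text \<open>Each vertex of \<open>X\<close> starts an inner arc. For three vertices one edge leaves
  a vertex uncovered, so there are two edges; the weaker bound 3 would not do in
  \<open>raised_part_inequality\<close>.\<close>

lemma inner_arcs_ge: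
  shows "card X \<le> card (E \<inter> X \<times> X)" and "card X = 3 \<Longrightarrow> 4 \<le> card (E \<inter> X \<times> X)"
proof -
  have fin: "finite (E \<inter> X \<times> X)" using finite_arcs by simp
  have "X \<subseteq> fst ` (E \<inter> X \<times> X)" using inner_neighbour(1) by force
  then show "card X \<le> card (E \<inter> X \<times> X)"
    using fin by (meson card_image_le card_mono finite_imageI le_trans)
  assume X: "card X = 3"
  obtain x y where xy: "x \<in> X" "y \<in> X" "(x, y) \<in> E" using nonempty_parts(1) inner_neighbour(1) by blast
  have "card (X - {x, y}) > 0"
    using X finite_parts
    by (subst card_Diff_subset) (use xy in \<open>auto simp: card_insert_if\<close>)
  then obtain z where z: "z \<in> X" "z \<noteq> x" "z \<noteq> y" by (fastforce simp: card_gt_0_iff)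
  obtain t where t: "t \<in> X" "(z, t) \<in> E" using z inner_neighbour(1) by blast
  \<comment> \<open>Even if \<open>t\<close> is \<open>x\<close> or \<open>y\<close>, the four arcs
    are distinct, as only the last two meet \<open>z\<close>.\<close>
  have "{(x, y), (y, x), (z, t), (t, z)} \<subseteq> E \<inter> X \<times> X"
    using xy z t sym_arcs by (auto dest: symD)
  then have "card {(x, y), (y, x), (z, t), (t, z)} \<le> card (E \<inter> X \<times> X)"
    using fin by (rule card_mono[rotated])
  moreover have "x \<noteq> y" "z \<noteq> t" using xy t no_loop by auto
  ultimately show "4 \<le> card (E \<inter> X \<times> X)" using z by auto
qed

text \<open>The assumption \<open>rayleigh\<close> is the Rayleigh bound times \<open>n\<close>,
  with the floor replaced by a bound from \<open>quotient_bounds\<close>. Keeping \<open>r\<close>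
  open lets each case pick the bound that suffices.\<close>

lemma rayleigh_contradiction:
  assumes \<delta>: "2 \<le> \<delta>"
    and rayleigh: "\<And>(x :: 'a \<Rightarrow> real) r. r = real n - 1 \<or> r = (real \<delta>)\<^sup>2 \<Longrightarrow>
      (4 * (real \<delta>)\<^sup>2 + (real n - real \<delta>)\<^sup>2 - r) * (\<Sum>v\<in>X \<union> Y \<union> C. (x v)\<^sup>2) + real n * (\<Sum>v\<in>X \<union> Y \<union> C. x v)\<^sup>2
      \<le> (real n)\<^sup>2 * (\<Sum>v\<in>X \<union> Y \<union> C. (x v)\<^sup>2) + real n * ((\<Sum>(u, v)\<in>E. (x u + x v)\<^sup>2) / 2)"
    and le: "card X \<le> card Y"
  shows False
proof -
  define a b c d N where "a = real (card X)" and "b = real (card Y)" and "c = real (card C)"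
    and "d = real \<delta>" and "N = real n"
  have N: "N = a + b + c" by (simp add: N_def n_def a_def b_def c_def)
  have d2: "2 \<le> d" using \<delta> by (simp add: d_def)
  have ac: "2 * d \<le> a + c" and bc: "2 * d \<le> b + c"
    using part_card_ge separation.part_card_ge[OF swapped]
    unfolding a_def b_def c_def d_def by linarith+
  have cd: "c \<le> d" using card_cut_le by (simp add: c_def d_def)
  have pos: "N > 0" using N d2 ac cd by (simp add: b_def)
  have plain: "4 * d\<^sup>2 + (N - d)\<^sup>2 - (N - 1) \<le> (a + c)\<^sup>2 + (b + c)\<^sup>2"
  proof -
    let ?S = "(\<Sum>(u, v)\<in>E. (1 + 1 :: real)\<^sup>2) / 2"
    have "?S = (\<Sum>(u, v)\<in>E. 2)" by (simp add: case_prod_unfold)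
    also have "\<dots> \<le> (a + c)\<^sup>2 + (b + c)\<^sup>2"
      using weighted_arc_bound[of "\<lambda>_. 1" "\<lambda>_ _. 2"] by (simp add: a_def b_def c_def)
    finally have S: "?S \<le> (a + c)\<^sup>2 + (b + c)\<^sup>2" .
    have card: "real (card (X \<union> Y \<union> C)) = N"
      using sum_parts(1)[of "\<lambda>_. 1"] by (simp add: N_def n_def)
    have "(4 * d\<^sup>2 + (N - d)\<^sup>2 - (N - 1)) * N + N * N\<^sup>2 \<le> N\<^sup>2 * N + N * ?S"
      using rayleigh[of "N - 1" "\<lambda>_. 1"] card by (simp add: N_def d_def)
    then have "N * (4 * d\<^sup>2 + (N - d)\<^sup>2 - (N - 1)) \<le> N * ?S" by (simp add: algebra_simps)
    then show ?thesis using S pos by simp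
  qed
  show False
  proof (cases "card C = \<delta>")
    case False
    then have c: "c \<le> d - 1" using card_cut_le by (simp add: c_def d_def)
    have "(a + c)\<^sup>2 + (b + c)\<^sup>2 \<le> (2 * d)\<^sup>2 + (N + c - 2 * d)\<^sup>2"
      using sum_squares_le[OF ac bc] by (simp add: N algebra_simps)
    \<comment> \<open>With this, \<open>plain\<close> would force \<open>N \<le> 2 * d\<close>,
      whereas \<open>a + c \<ge> 2 * d\<close> and \<open>b > 0\<close>.\<close>
    also have "(N + c - 2 * d)\<^sup>2 \<le> (N - d - 1)\<^sup>2"
      using c N ac bc d2 by (intro power_mono) auto
    finally show False using plain ac bc c d2 N by (simp add: power2_eq_square algebra_simps)
  next
    case True
    then have c: "c = d" by (simp add: c_def d_def)
    have Nge: "2 * a + d \<le> N" using le N c by (simp add: a_def b_def)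
    show False
    proof (cases "card X = \<delta>")
      case True
      then have a: "a = d" by (simp add: a_def d_def)
      define x where "x v = (if v \<in> X then 3/2 else 1 :: real)" for v
      define s where "s = real (card (E \<inter> X \<times> X))"
      have "v \<notin> X" if "v \<in> Y \<union> C" for v using that disjoint_parts by blast
      then have sums: "sum (\<lambda>v. (x v)\<^sup>2) (X \<union> Y \<union> C) = N + 5/4 * d" "sum x (X \<union> Y \<union> C) = N + d / 2"
        using N a by (simp_all add: sum_parts x_def a_def b_def c_def power2_eq_square)
      have S: "(\<Sum>(u, v)\<in>E. (x u + x v)\<^sup>2) / 2 \<le> (N - d)\<^sup>2 + 25/4 * d\<^sup>2 - 7/4 * s"
        using raised_part_arc_bound[OF True \<open>card C = \<delta>\<close>] by (simp add: x_def N_def d_def s_def)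
      have ineq: "(4 * d\<^sup>2 + (N - d)\<^sup>2 - r) * (N + 5/4 * d) + N * (N + d / 2)\<^sup>2
        \<le> N\<^sup>2 * (N + 5/4 * d) + N * ((N - d)\<^sup>2 + 25/4 * d\<^sup>2 - 7/4 * s)"
        if "r = N - 1 \<or> r = d\<^sup>2" for r
        using rayleigh[of r x] that mult_left_mono[OF S, of N] pos
        unfolding sums N_def[symmetric] d_def[symmetric] by linarith
      \<comment> \<open>For \<open>\<delta> = 3\<close>, \<open>Nge\<close> gives
        \<open>N \<ge> 9\<close>, so only \<open>N = 9\<close> needs separate treatment.\<close>
      have "\<exists>r. (r = N - 1 \<or> r = d\<^sup>2) \<and>
        ((d = 2 \<and> r = d\<^sup>2 \<and> 2 \<le> s) \<or> (d = 3 \<and> 10 \<le> N \<and> r = d\<^sup>2 \<and> 4 \<le> s)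
        \<or> (d = 3 \<and> N = 9 \<and> r = N - 1 \<and> 4 \<le> s) \<or> (4 \<le> d \<and> r = N - 1 \<and> d \<le> s))"
      proof -
        have "\<delta> = 2 \<or> \<delta> = 3 \<or> 4 \<le> \<delta>" using \<delta> by linarith
        moreover have "n = 9 \<or> 10 \<le> n" if "\<delta> = 3"
          using that Nge a by (simp add: N_def d_def) linarith
        ultimately show ?thesis
          using inner_arcs_ge True by (auto simp: d_def s_def N_def)
      qed
      then obtain r where "r = N - 1 \<or> r = d\<^sup>2"
        "(d = 2 \<and> r = d\<^sup>2 \<and> 2 \<le> s) \<or> (d = 3 \<and> 10 \<le> N \<and> r = d\<^sup>2 \<and> 4 \<le> s)
        \<or> (d = 3 \<and> N = 9 \<and> r = N - 1 \<and> 4 \<le> s) \<or> (4 \<le> d \<and> r = N - 1 \<and> d \<le> s)" by blast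
      then show False using ineq[of r] raised_part_inequality[of d r s N] Nge a by linarith
    next
      case False
      then have a: "d + 1 \<le> a"
        using part_card_ge \<open>card C = \<delta>\<close> by (simp add: a_def d_def)
      then have b: "d + 1 \<le> b" using le by (simp add: a_def b_def)
      have squares: "(a + c)\<^sup>2 + (b + c)\<^sup>2 \<le> (N - d - 1)\<^sup>2 + (2 * d + 1)\<^sup>2"
        using sum_squares_le[of "2 * d + 1" "a + c" "b + c"] a b by (simp add: N c algebra_simps)
      show False
      proof (cases "n \<le> 6 * \<delta> + 1")
        case False
        then have "6 * d + 1 < N" unfolding d_def N_def by linarith
        \<comment> \<open>The constant vector yields exactly \<open>N \<le> 6 * d + 1\<close>, which
          explains the threshold.\<close>
        then show False using plain squares by (simp add: power2_eq_square algebra_simps)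
      next
        case True
        then have Nle: "N \<le> 6 * d + 1" unfolding d_def N_def by linarith
        define x where "x v = (if v \<in> C then 1/2 else 1 :: real)" for v
        \<comment> \<open>The arc bound is an equality except inside \<open>C\<close>, where it
          reads 1/2 against 81/128.\<close>
        define w where "w v = (if v \<in> C then 9/16 else 1 :: real)" for v
        have "v \<notin> C" if "v \<in> X \<or> v \<in> Y" for v using that disjoint_parts by blast
        then have sums: "sum (\<lambda>v. (x v)\<^sup>2) (X \<union> Y \<union> C) = N - 3/4 * d" "sum x (X \<union> Y \<union> C) = N - d / 2"
          "sum w X = a" "sum w Y = b" "sum w C = 9/16 * d"
          using N c by (simp_all add: sum_parts x_def w_def a_def b_def c_def power2_eq_square)
        have "(\<Sum>(u, v)\<in>E. (x u + x v)\<^sup>2) / 2 = (\<Sum>(u, v)\<in>E. (x u + x v)\<^sup>2 / 2)"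
          by (simp add: sum_divide_distrib case_prod_unfold)
        also have "\<dots> \<le> (a + 9/16 * d)\<^sup>2 + (b + 9/16 * d)\<^sup>2"
          using weighted_arc_bound[of w "\<lambda>u v. (x u + x v)\<^sup>2 / 2"]
          unfolding sums by (simp add: w_def x_def power2_eq_square)
        \<comment> \<open>Here 9/16 = 1 - 7/16, and the two bases \<open>a + c\<close> and
          \<open>b + c\<close> add up to \<open>N + d\<close>.\<close>
        also have "\<dots> = (a + c)\<^sup>2 + (b + c)\<^sup>2 - 7/8 * d * (N + d) + 49/128 * d\<^sup>2"
          by (simp add: N c power2_eq_square field_simps)
        finally have S: "(\<Sum>(u, v)\<in>E. (x u + x v)\<^sup>2) / 2
          \<le> (N - d - 1)\<^sup>2 + (2 * d + 1)\<^sup>2 - 7/8 * d * (N + d) + 49/128 * d\<^sup>2"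
          using squares by linarith
        have ineq: "(4 * d\<^sup>2 + (N - d)\<^sup>2 - r) * (N - 3/4 * d) + N * (N - d / 2)\<^sup>2
          \<le> N\<^sup>2 * (N - 3/4 * d)
            + N * ((N - d - 1)\<^sup>2 + (2 * d + 1)\<^sup>2 - 7/8 * d * (N + d) + 49/128 * d\<^sup>2)"
          if "r = N - 1 \<or> r = d\<^sup>2" for r
          using rayleigh[of r x] that mult_left_mono[OF S, of N] pos
          unfolding sums N_def[symmetric] d_def[symmetric] by linarith
        have "\<delta> = 2 \<or> \<delta> = 3 \<or> 4 \<le> \<delta>" using \<delta> by linarith
        then obtain r where "r = N - 1 \<or> r = d\<^sup>2"
          "(d = 2 \<and> r = d\<^sup>2) \<or> (d = 3 \<and> r = d\<^sup>2) \<or> (4 \<le> d \<and> r = N - 1)"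
          by (auto simp: d_def)
        then show False
          using ineq[of r] halved_cut_inequality[of d r N] Nle Nge a by linarith
      qed
    qed
  qed
qed

end

end

section \<open>Vertex-cuts\<close>

text \<open>The arcs are already symmetric, so the symmetric closure in the definition of
  connectedness adds none.\<close>

lemma (in pair_graph) connected_del_verts_iff:
  "Digraph_Component.connected (del_verts G C) \<longleftrightarrow> pverts G - C \<noteq> {} \<and>
    (\<forall>u\<in>pverts G - C. \<forall>v\<in>pverts G - C.
      (u, v) \<in> rtrancl_on (pverts G - C) (parcs G \<inter> (pverts G - C) \<times> (pverts G - C)))"
proof -
  let ?W = "pverts G - C" and ?R = "parcs G \<inter> (pverts G - C) \<times> (pverts G - C)"
  have "sym (parcs G)" using pair_sym_arcs by (simp add: symmetric_def)
  then have "mk_symmetric (del_verts G C) = \<lparr>pverts = ?W, parcs = ?R\<rparr>"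
    by (auto simp: mk_symmetric_def dest: symD)
  then show ?thesis
    by (simp add: Digraph_Component.connected_def strongly_connected_def reachable_def)
qed

text \<open>One side is the set of vertices reachable from a vertex that fails to reach some
  other.\<close>

lemma (in pair_graph) disconnected_split:
  assumes "\<not> Digraph_Component.connected (del_verts G C)" "pverts G - C \<noteq> {}"
  obtains X Y where "X \<union> Y = pverts G - C" "X \<inter> Y = {}" "X \<noteq> {}" "Y \<noteq> {}"
    "\<And>u v. u \<in> X \<Longrightarrow> v \<in> Y \<Longrightarrow> (u, v) \<notin> parcs G"
proof -
  let ?W = "pverts G - C" and ?R = "parcs G \<inter> (pverts G - C) \<times> (pverts G - C)"
  obtain u v where uv: "u \<in> ?W" "v \<in> ?W" "(u, v) \<notin> rtrancl_on ?W ?R"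
    using assms by (auto simp: connected_del_verts_iff)
  define X where "X = {w. (u, w) \<in> rtrancl_on ?W ?R}"
  have XW: "X \<subseteq> ?W" by (auto simp: X_def dest: in_rtrancl_on_in_F)
  show thesis
  proof (rule that[of X "?W - X"])
    show "X \<union> (?W - X) = ?W" using XW by blast
    show "X \<noteq> {}" using uv(1) by (auto simp: X_def)
    show "?W - X \<noteq> {}" using uv by (auto simp: X_def)
    show "(w, w') \<notin> parcs G" if "w \<in> X" "w' \<in> ?W - X" for w w'
    proof
      assume "(w, w') \<in> parcs G"
      then have "(w, w') \<in> ?R" using that XW by blast
      moreover have "(u, w) \<in> rtrancl_on ?W ?R" using that(1) by (simp add: X_def)
      ultimately have "(u, w') \<in> rtrancl_on ?W ?R"
        using that(2) by (meson DiffD1 rtrancl_on_into_rtrancl_on)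
      then show False using that by (simp add: X_def)
    qed
  qed blast
qed

text \<open>Without its neighbours \<open>v\<close> reaches only itself, so the rest is disconnected
  or just \<open>v\<close>. At a vertex of least degree this bounds the connectivity by
  \<delta>.\<close>

lemma (in pair_graph) vertex_cut_neighbourhood:
  assumes v: "v \<in> pverts G"
  shows "vertex_cut G (parcs G `` {v})"
proof -
  let ?N = "parcs G `` {v}"
  let ?W = "pverts G - ?N" and ?R = "parcs G \<inter> (pverts G - ?N) \<times> (pverts G - ?N)"
  have vN: "v \<in> ?W" using v pair_no_loops by fastforce
  have "?W = {v}" if "Digraph_Component.connected (del_verts G ?N)"
  proof -
    have "w = v" if w: "w \<in> ?W" for w
    proof -
      have "(v, w) \<in> rtrancl_on ?W ?R"
        using \<open>Digraph_Component.connected _\<close> vN w unfolding connected_del_verts_iff by blast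
      then show ?thesis by (induction rule: rtrancl_on_induct) auto
    qed
    then show ?thesis using vN by blast
  qed
  then have "\<not> Digraph_Component.connected (del_verts G ?N) \<or> card ?W = 1" by auto
  moreover have "?N \<subseteq> pverts G" using in_arcsD2 by auto
  ultimately show ?thesis
    using vN by (auto simp: vertex_cut_def)
qed

lemma (in pair_graph) isolates_iff:
  "isolates G C v \<longleftrightarrow> v \<in> pverts G - C \<and> parcs G `` {v} \<subseteq> C"
proof -
  have "finite (out_arcs (del_verts G C) v)"
    using pair_finite_arcs by (rule rev_finite_subset) auto
  then have "out_degree (del_verts G C) v = 0 \<longleftrightarrow> out_arcs (del_verts G C) v = {}"
    by (simp add: out_degree_def)
  then show ?thesis
    using in_arcsD2 by (fastforce simp: isolates_def out_arcs_def)
qed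

section \<open>From a bad minimum cut to a separation and a contradiction\<close>

theorem theorem5p7:
  fixes G :: "'a pair_pre_digraph" and n \<delta> :: nat
  assumes "pair_graph G"
    and "Digraph_Component.connected (with_proj G)"
    and "triangle_free G"
    and "card (pverts G) = n"
    and "min_degree G = \<delta>"
    and "\<delta> \<ge> 2"
    and "Digraph_Component.connected (with_proj (complement_graph G))"
    and "Q_index (complement_graph G)
           \<le> 2 * (real n - 1) - 4 * (real \<delta>)\<^sup>2 / real n
              - real_of_int \<lfloor>(real n - real \<delta>)\<^sup>2 / real n\<rfloor>"
  shows "super_kappa G"
proof (rule ccontr)
  assume "\<not> super_kappa G"
  interpret pair_graph G by fact
  let ?V = "pverts G" and ?E = "parcs G"
  have fin: "finite ?V" by (rule pair_finite_verts)
  have sub: "?E \<subseteq> ?V \<times> ?V" using in_arcsD1 in_arcsD2 by auto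
  have sym: "sym ?E" using pair_sym_arcs by (simp add: symmetric_def)
  have tf: "(w, u) \<notin> ?E" if "(u, v) \<in> ?E" "(v, w) \<in> ?E" for u v w
    using assms(3) that unfolding triangle_free_def by blast
  then have irr: "(v, v) \<notin> ?E" for v by blast
  have ne: "?V \<noteq> {}"
    using assms(2) by (auto simp: Digraph_Component.connected_def strongly_connected_def mk_symmetric_def)
  have degree_ge: "\<delta> \<le> card (?E `` {v})" if "v \<in> ?V" for v
    using that fin assms(5) by (auto simp: min_degree_def out_degree_with_proj)
  have "\<delta> \<in> out_degree (with_proj G) ` ?V"
    using fin ne assms(5) unfolding min_degree_def by (metis Max_in Min_in finite_imageI image_is_empty)
  then obtain v0 where v0: "v0 \<in> ?V" "card (?E `` {v0}) = \<delta>" by (auto simp: out_degree_with_proj)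
  have "?E `` {v0} \<subset> ?V" using sub irr v0 by blast
  then have "\<delta> < n" using psubset_card_mono[OF fin] v0 assms(4) by metis

  from \<open>\<not> super_kappa G\<close> obtain C where "minimum_vertex_cut G C"
    and not_iso: "\<And>v. isolates G C v \<Longrightarrow> out_degree (with_proj G) v \<noteq> \<delta>"
    using assms(5) by (auto simp: super_kappa_def)
  then have cut: "vertex_cut G C" and card_C: "card C = vertex_connectivity G"
    by (auto simp: minimum_vertex_cut_def)
  have CV: "C \<subseteq> ?V" and "C \<noteq> ?V"
    and cut': "\<not> Digraph_Component.connected (del_verts G C) \<or> card (?V - C) = 1"
    using cut by (auto simp: vertex_cut_def)
  then have W_ne: "?V - C \<noteq> {}" by blast
  have "finite {C. vertex_cut G C}"
    by (rule finite_subset[of _ "Pow ?V"]) (use fin in \<open>auto simp: vertex_cut_def\<close>)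
  then have C_le: "card C \<le> \<delta>"
    using vertex_cut_neighbourhood[OF v0(1)] v0(2) unfolding card_C vertex_connectivity_def
    by (metis Min_le finite_imageI imageI mem_Collect_eq)
  \<comment> \<open>A vertex with all neighbours in \<open>C\<close> would have degree exactly
    \<delta> and be isolated by \<open>C\<close>, which \<open>not_iso\<close> forbids.\<close>
  have not_sub: "\<not> ?E `` {v} \<subseteq> C" if v: "v \<in> ?V - C" for v
  proof
    assume sub_C: "?E `` {v} \<subseteq> C"
    then have "card (?E `` {v}) \<le> card C"
      using fin CV by (meson card_mono finite_subset)
    then have "card (?E `` {v}) = \<delta>" using degree_ge[of v] C_le v by simp
    moreover have "isolates G C v" using v sub_C by (simp add: isolates_iff)
    ultimately show False using not_iso by (simp add: out_degree_with_proj)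
  qed
  then have outer_neighbour: "\<exists>w\<in>?V - C. (v, w) \<in> ?E" if "v \<in> ?V - C" for v
    using that sub by blast
  \<comment> \<open>This rules out the single-vertex clause of \<open>vertex_cut\<close>: a sole
    remaining vertex would need a loop.\<close>
  have "card (?V - C) \<noteq> 1"
    using outer_neighbour irr by (metis card_1_singletonE singletonD singletonI)
  with cut' obtain X Y where XY: "X \<union> Y = ?V - C" "X \<inter> Y = {}" "X \<noteq> {}" "Y \<noteq> {}"
    and no_arc: "\<And>u v. u \<in> X \<Longrightarrow> v \<in> Y \<Longrightarrow> (u, v) \<notin> ?E"
    using disconnected_split[OF _ W_ne] by metis
  have no_arc': "(v, u) \<notin> ?E" if "u \<in> X" "v \<in> Y" for u v
    using no_arc[OF that] sym by (auto dest: symD)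
  have V: "?V = X \<union> Y \<union> C" using XY(1) CV by blast
  have "separation ?E X Y C \<delta>"
  proof
    show "finite X" "finite Y" "finite C" using fin unfolding V by simp_all
    show "X \<inter> Y = {}" by fact
    show "X \<inter> C = {}" "Y \<inter> C = {}" using XY(1) by blast+
    show "?E \<subseteq> (X \<union> C) \<times> (X \<union> C) \<union> (Y \<union> C) \<times> (Y \<union> C)"
      using sub no_arc no_arc' unfolding V by blast
    show "\<exists>v\<in>X. (u, v) \<in> ?E" if "u \<in> X" for u
      using outer_neighbour[of u] no_arc[OF that] that XY(1) by blast
    show "\<exists>v\<in>Y. (u, v) \<in> ?E" if "u \<in> Y" for u
      using outer_neighbour[of u] no_arc'[of _ u] that XY(1) by blast
    show "\<delta> \<le> card (?E `` {v})" if "v \<in> X \<union> Y \<union> C" for v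
      using degree_ge that unfolding V .
  qed (fact sym tf XY C_le)+
  then interpret S: separation ?E X Y C \<delta> .

  have n: "n = card X + card Y + card C"
    using assms(4) S.finite_parts S.disjoint_parts unfolding V
    by (simp add: card_Un_disjoint Int_Un_distrib2)
  define F where "F = 4 * (real \<delta>)\<^sup>2 / real n + real_of_int \<lfloor>(real n - real \<delta>)\<^sup>2 / real n\<rfloor>"
  have q: "Q_index (complement_graph G) \<le> 2 * (real n - 1) - F"
    using assms(8) by (simp add: F_def)
  have rayleigh: "(4 * (real \<delta>)\<^sup>2 + (real n - real \<delta>)\<^sup>2 - r) * (\<Sum>v\<in>?V. (x v)\<^sup>2) + real n * (\<Sum>v\<in>?V. x v)\<^sup>2
      \<le> (real n)\<^sup>2 * (\<Sum>v\<in>?V. (x v)\<^sup>2) + real n * ((\<Sum>(u, v)\<in>?E. (x u + x v)\<^sup>2) / 2)"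
    if r: "r = real n - 1 \<or> r = (real \<delta>)\<^sup>2" for x :: "'a \<Rightarrow> real" and r
  proof -
    define N s A where "N = (\<Sum>v\<in>?V. (x v)\<^sup>2)" and "s = (\<Sum>v\<in>?V. x v)\<^sup>2"
      and "A = (\<Sum>(u, v)\<in>?E. (x u + x v)\<^sup>2) / 2"
    have N: "0 \<le> N" by (simp add: N_def sum_nonneg)
    have "(real n - 2) * N + s - A \<le> Q_index (complement_graph G) * N"
      using Q_index_complement_rayleigh[OF fin ne sub sym irr] assms(4) by (simp add: N_def s_def A_def)
    also have "\<dots> \<le> (2 * (real n - 1) - F) * N" using q N by (rule mult_right_mono)
    finally have "F * N + s \<le> real n * N + A" by (simp add: algebra_simps)
    then have "real n * (F * N + s) \<le> real n * (real n * N + A)" by (rule mult_left_mono) simp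
    \<comment> \<open>Multiplication by \<open>n\<close> clears the quotient, and \<open>r\<close>
      takes the place of the remainder lost to the floor.\<close>
    moreover have "(4 * (real \<delta>)\<^sup>2 + (real n - real \<delta>)\<^sup>2 - r) * N \<le> real n * F * N"
      using r quotient_bounds[OF \<open>\<delta> < n\<close>] N unfolding F_def[symmetric]
      by (intro mult_right_mono) auto
    ultimately show ?thesis
      unfolding N_def[symmetric] s_def[symmetric] A_def[symmetric]
      by (simp add: power2_eq_square algebra_simps)
  qed
  consider "card X \<le> card Y" | "card Y \<le> card X" by linarith
  then show False
  proof cases
    case 1
    with assms(6) rayleigh show False
      unfolding V n by (rule S.rayleigh_contradiction)
  next
    case 2
    have V': "?V = Y \<union> X \<union> C" and n': "n = card Y + card X + card C" using V n by auto
    from assms(6) rayleigh 2 show False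
      unfolding V' n' by (rule separation.rayleigh_contradiction[OF S.swapped])
  qed
qed

end
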